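(* Let $G$ be a graph with $2r$ edges, where $r$ is the rank of the cycle matroid $M(G)$. Then the single exchange graph $\mathfrak{G}(M(G))$ is connected.
   Context: The cycle matroid $M(G)$ of a graph $G$ has ground set $E(G)$ and its bases are the spanning forests of $G$ (maximal acyclic edge subsets); its rank is $|V(G)|$ minus the number of connected components of $G$. For a matroid $M$ of rank $r$ on a ground set of size $2r$, the single exchange graph $\mathfrak{G}(M)$ is the graph whose vertices are the ordered pairs $(B_1,B_2)$ of disjoint bases of $M$, with an edge between $(B_1,B_2)$ and $(D_1,D_2)$ if and only if $|B_1\cap D_1|=r-1$ (equivalently, $(D_1,D_2)$ is obtained from $(B_1,B_2)$ by exchanging one element $b\in B_1$ with one element $d\in B_2$ so that both resulting sets are bases). *)

theory Defs
  imports Main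
begin

text \<open>A finite multigraph (loops and parallel edges allowed): vertex set V, edge set E,
  and an incidence map giving the set of (one or two) end vertices of each edge.\<close>
definition graph :: "'v set \<Rightarrow> 'e set \<Rightarrow> ('e \<Rightarrow> 'v set) \<Rightarrow> bool" where
  "graph V E inc \<longleftrightarrow> finite V \<and> finite E \<and>
     (\<forall>e\<in>E. inc e \<subseteq> V \<and> (card (inc e) = 1 \<or> card (inc e) = 2))"

definition has_cycle :: "('e \<Rightarrow> 'v set) \<Rightarrow> 'e set \<Rightarrow> bool" where
  "has_cycle inc F \<longleftrightarrow> (\<exists>vs es. length vs = length es \<and> length es \<ge> 1 \<and>
     distinct vs \<and> distinct es \<and> set es \<subseteq> F \<and>
     (\<forall>i < length es. inc (es ! i) = {vs ! i, vs ! ((i + 1) mod length es)}))"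

definition acyclic_set :: "'e set \<Rightarrow> ('e \<Rightarrow> 'v set) \<Rightarrow> 'e set \<Rightarrow> bool" where
  "acyclic_set E inc F \<longleftrightarrow> F \<subseteq> E \<and> \<not> has_cycle inc F"

definition cm_basis :: "'e set \<Rightarrow> ('e \<Rightarrow> 'v set) \<Rightarrow> 'e set \<Rightarrow> bool" where
  "cm_basis E inc B \<longleftrightarrow> acyclic_set E inc B \<and>
     (\<forall>F. acyclic_set E inc F \<and> B \<subseteq> F \<longrightarrow> F = B)"

definition cm_rank :: "'e set \<Rightarrow> ('e \<Rightarrow> 'v set) \<Rightarrow> nat" where
  "cm_rank E inc = Max (card ` {F. acyclic_set E inc F})"

definition exch_vertices :: "'e set \<Rightarrow> ('e \<Rightarrow> 'v set) \<Rightarrow> ('e set \<times> 'e set) set" where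
  "exch_vertices E inc = {(B1, B2). cm_basis E inc B1 \<and> cm_basis E inc B2 \<and> B1 \<inter> B2 = {}}"

definition exch_adj :: "'e set \<Rightarrow> ('e \<Rightarrow> 'v set) \<Rightarrow> ('e set \<times> 'e set) \<Rightarrow> ('e set \<times> 'e set) \<Rightarrow> bool" where
  "exch_adj E inc X Y \<longleftrightarrow> X \<in> exch_vertices E inc \<and> Y \<in> exch_vertices E inc \<and>
     card (fst X \<inter> fst Y) = cm_rank E inc - 1"

definition exch_graph_connected :: "'e set \<Rightarrow> ('e \<Rightarrow> 'v set) \<Rightarrow> bool" where
  "exch_graph_connected E inc \<longleftrightarrow>
     (\<forall>X\<in>exch_vertices E inc. \<forall>Y\<in>exch_vertices E inc. (exch_adj E inc)\<^sup>*\<^sup>* X Y)"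

end

theory Submission
  imports Defs
begin

text \<open>
  More generally, the partitions of the edges of any graph into two forests are connected under
  moving one edge or exchanging two. If the number of edges is
  twice the rank, both forests are bases and every such step is a basis exchange.

  A union of two forests on \<open>n\<close> non-isolated vertices has at most \<open>2(n - 1)\<close> edges, hence a vertex
  \<open>v\<close> of degree at most 3, and one inducts on the number of edges. If the degree is at most 2, the
  edges at \<open>v\<close> can be distributed over the two forests independently of the rest. If
  \<open>v\<close> has edges \<open>a\<close>, \<open>b\<close>, \<open>c\<close> to \<open>x\<close>, \<open>y\<close>, \<open>z\<close>, the partitions separating \<open>c\<close> from \<open>a\<close>, \<open>b\<close> correspond to the
  partitions for the graph in which \<open>v\<close> is replaced by an edge \<open>xy\<close>. A step of the smaller graph that
  shifts \<open>xy\<close> lifts to two steps, because the forest that contained \<open>xy\<close>, after deleting \<open>xy\<close>,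
  joins \<open>z\<close> to at most one of \<open>x\<close>, \<open>y\<close>, so that \<open>c\<close> can be exchanged with \<open>a\<close> or with \<open>b\<close>. The
  same exchange links the three classes given by the separated edge.
\<close>

section \<open>Connectivity and forests\<close>

definition conn :: "('e \<Rightarrow> 'v set) \<Rightarrow> 'e set \<Rightarrow> 'v \<Rightarrow> 'v \<Rightarrow> bool" where
  "conn inc F = (\<lambda>x y. \<exists>e\<in>F. inc e = {x, y})\<^sup>*\<^sup>*"

text \<open>Every edge is a bridge; loops are excluded because \<open>conn\<close> is reflexive.
  Insertion of an edge is easier to follow in this form than through the lists of
  \<open>has_cycle\<close>; \<open>cycle_iff_not_forest\<close> shows that the two agree.\<close>

definition forest :: "('e \<Rightarrow> 'v set) \<Rightarrow> 'e set \<Rightarrow> bool" where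
  "forest inc F \<longleftrightarrow> (\<forall>e\<in>F. \<forall>x y. inc e = {x, y} \<longrightarrow> \<not> conn inc (F - {e}) x y)"

lemma conn_refl [simp]: "conn inc F x x"
  by (simp add: conn_def)

lemma conn_edge: "e \<in> F \<Longrightarrow> inc e = {x, y} \<Longrightarrow> conn inc F x y"
  unfolding conn_def by (rule r_into_rtranclp) blast

lemma conn_trans: "conn inc F x y \<Longrightarrow> conn inc F y z \<Longrightarrow> conn inc F x z"
  unfolding conn_def by (rule rtranclp_trans)

lemma conn_sym: "conn inc F x y \<Longrightarrow> conn inc F y x"
proof -
  assume "conn inc F x y"
  moreover have "symp (\<lambda>x y. \<exists>e\<in>F. inc e = {x, y})"
    by (auto intro!: sympI simp: insert_commute)
  ultimately show ?thesis
    unfolding conn_def by (blast intro: sympD[OF symp_rtranclp])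
qed

lemma conn_mono: "conn inc F x y \<Longrightarrow> F \<subseteq> H \<Longrightarrow> conn inc H x y"
  unfolding conn_def by (erule rtranclp_mono[THEN predicate2D, rotated]) blast

lemma conn_cong: "(\<And>e. e \<in> F \<Longrightarrow> inc e = inc' e) \<Longrightarrow> conn inc F = conn inc' F"
  unfolding conn_def by (rule arg_cong[of _ _ rtranclp]) (auto simp: fun_eq_iff)

lemma conn_isolated:
  assumes "conn inc F v x" "\<forall>e\<in>F. v \<notin> inc e"
  shows "x = v"
  using assms(1) unfolding conn_def
  by (cases rule: converse_rtranclpE) (use assms(2) in auto)

text \<open>A walk can be shortened until it uses \<open>f\<close> at most once, in one of its two
  directions.\<close>

lemma conn_insert:
  assumes f: "inc f = {x, y}"
  shows "conn inc (insert f F) u w \<longleftrightarrow>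
    conn inc F u w \<or> conn inc F u x \<and> conn inc F y w \<or> conn inc F u y \<and> conn inc F x w"
    (is "?L \<longleftrightarrow> ?R w")
proof
  assume ?L
  then show "?R w" unfolding conn_def[of inc "insert f F"]
  proof (induction rule: rtranclp_induct)
    case (step s t)
    then obtain e where e: "e \<in> insert f F" "inc e = {s, t}" by blast
    show ?case
    proof (cases "e \<in> F")
      case True
      then have "conn inc F s t" using e by (auto intro: conn_edge)
      then show ?thesis using step.IH by (meson conn_trans)
    next
      case False
      then have "s = x \<and> t = y \<or> s = y \<and> t = x" using e f by (auto simp: doubleton_eq_iff)
      then show ?thesis using step.IH by (meson conn_trans conn_sym conn_refl)
    qed
  qed simp
next
  assume R: "?R w"
  have xy: "conn inc (insert f F) x y" using f by (auto intro: conn_edge)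
  have "\<And>p q. conn inc F p q \<Longrightarrow> conn inc (insert f F) p q"
    by (erule conn_mono) blast
  then show ?L using R xy by (meson conn_trans conn_sym)
qed

lemma forest_cong: "(\<And>e. e \<in> F \<Longrightarrow> inc e = inc' e) \<Longrightarrow> forest inc F = forest inc' F"
  unfolding forest_def
  by (intro ball_cong refl) (metis (no_types, lifting) DiffD1 conn_cong)

lemma forest_subset: "forest inc F \<Longrightarrow> H \<subseteq> F \<Longrightarrow> forest inc H"
  unfolding forest_def by (meson Diff_mono conn_mono order_refl subsetD)

lemma forest_empty [simp]: "forest inc {}"
  by (simp add: forest_def)

lemma forest_ends_neq: "forest inc F \<Longrightarrow> e \<in> F \<Longrightarrow> inc e = {x, y} \<Longrightarrow> x \<noteq> y"
  unfolding forest_def by (metis conn_refl)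

text \<open>If an edge \<open>e\<close> of \<open>F\<close> stopped being a bridge,
  \<open>F - {e}\<close> would join its ends to the two ends of \<open>f\<close>, and
  \<open>e\<close> would complete a walk from \<open>x\<close> to \<open>y\<close> in
  \<open>F\<close>.\<close>

lemma forest_insert:
  assumes f: "inc f = {x, y}" "f \<notin> F"
  shows "forest inc (insert f F) \<longleftrightarrow> forest inc F \<and> \<not> conn inc F x y"
proof
  assume L: "forest inc (insert f F)"
  then have "\<not> conn inc (insert f F - {f}) x y" using f unfolding forest_def by blast
  then show "forest inc F \<and> \<not> conn inc F x y"
    using f L by (auto intro: forest_subset)
next
  assume R: "forest inc F \<and> \<not> conn inc F x y"
  show "forest inc (insert f F)" unfolding forest_def
  proof (intro ballI allI impI)
    fix e u w assume e: "e \<in> insert f F" "inc e = {u, w}"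
    show "\<not> conn inc (insert f F - {e}) u w"
    proof (cases "e = f")
      case True
      then show ?thesis using R e f
        by (metis Diff_insert_absorb conn_sym doubleton_eq_iff)
    next
      case False
      then have eF: "e \<in> F" using e by simp
      have *: "insert f F - {e} = insert f (F - {e})" using False by blast
      have n: "\<not> conn inc (F - {e}) u w" using R eF e unfolding forest_def by blast
      have m: "\<And>p q. conn inc (F - {e}) p q \<Longrightarrow> conn inc F p q"
        by (erule conn_mono) blast
      have uw: "conn inc F u w" using eF e by (auto intro: conn_edge)
      show ?thesis unfolding * conn_insert[of inc f x y, OF f(1)]
        using n R m uw by (meson conn_trans conn_sym)
    qed
  qed
qed

lemma forest_insert_leaf:
  assumes "inc a = {v, x}" "x \<noteq> v" "\<forall>e\<in>F. v \<notin> inc e"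
  shows "forest inc (insert a F) \<longleftrightarrow> forest inc F"
proof -
  have "a \<notin> F" using assms by blast
  then show ?thesis using forest_insert assms conn_isolated by metis
qed

text \<open>The path through \<open>v\<close> formed by \<open>a\<close> and \<open>b\<close> acts
  as a single edge from \<open>x\<close> to \<open>y\<close>. The replacement of a vertex of degree
  3 by an edge rests on this.\<close>

lemma forest_insert_two:
  assumes a: "inc a = {v, x}" "x \<noteq> v" and b: "inc b = {v, y}" "y \<noteq> v"
    and ab: "a \<noteq> b" and F: "\<forall>e\<in>F. v \<notin> inc e"
  shows "forest inc (insert a (insert b F)) \<longleftrightarrow> forest inc F \<and> \<not> conn inc F x y"
proof -
  have "a \<notin> insert b F" using a ab F by blast
  then have "forest inc (insert a (insert b F)) \<longleftrightarrow>
      forest inc (insert b F) \<and> \<not> conn inc (insert b F) v x"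
    using forest_insert a by metis
  also have "forest inc (insert b F) \<longleftrightarrow> forest inc F"
    using forest_insert_leaf b F by metis
  also have "conn inc (insert b F) v x \<longleftrightarrow> conn inc F x y"
    unfolding conn_insert[of inc b v y, OF b(1)] using a b F by (meson conn_isolated conn_refl conn_sym)
  finally show ?thesis .
qed

section \<open>Components and the number of edges of a forest\<close>

definition components :: "'v set \<Rightarrow> ('e \<Rightarrow> 'v set) \<Rightarrow> 'e set \<Rightarrow> 'v set set" where
  "components V inc F = (\<lambda>u. {w. conn inc F u w}) ` V"

lemma component_eq_iff: "{w. conn inc F u w} = {w. conn inc F v w} \<longleftrightarrow> conn inc F u v"
  by (auto intro: conn_trans conn_sym)

text \<open>Each edge added to a forest merges exactly two components.\<close>

lemma card_forest_components:
  assumes "finite F" "finite V" "forest inc F"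
    and "\<And>e. e \<in> F \<Longrightarrow> inc e \<subseteq> V \<and> (\<exists>x y. inc e = {x, y})"
  shows "card F + card (components V inc F) = card V"
  using assms
proof (induction F rule: finite_induct)
  case empty
  have "conn inc {} u = (\<lambda>w. w = u)" for u
    by (auto simp: fun_eq_iff dest: conn_isolated)
  then have "components V inc {} = (\<lambda>u. {u}) ` V" by (simp add: components_def)
  then show ?case by (simp add: card_image)
next
  case (insert f F)
  obtain x y where f: "inc f = {x, y}" "x \<in> V" "y \<in> V" using insert.prems(3)[of f] by auto
  have F: "forest inc F" "\<not> conn inc F x y"
    using insert.prems(2) forest_insert[of inc f x y, OF f(1) insert.hyps(2)] by auto
  let ?C = "\<lambda>u. {w. conn inc F u w}"
  let ?D = "\<lambda>u. {w. conn inc (insert f F) u w}"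
  have D1: "?D u = ?C x \<union> ?C y" if "conn inc F u x \<or> conn inc F u y" for u
    using that unfolding conn_insert[of inc f x y, OF f(1)] by (auto intro: conn_trans conn_sym)
  have D2: "?D u = ?C u" if "\<not> (conn inc F u x \<or> conn inc F u y)" for u
    using that unfolding conn_insert[of inc f x y, OF f(1)] by auto
  \<comment> \<open>The classes of \<open>x\<close> and \<open>y\<close> give way to their union;
    all others stay.\<close>
  have "components V inc (insert f F) =
      insert (?C x \<union> ?C y) (components V inc F - {?C x, ?C y})" (is "?l = ?r")
  proof
    show "?l \<subseteq> ?r"
    proof
      fix K assume "K \<in> ?l"
      then obtain u where u: "u \<in> V" "K = ?D u" by (auto simp: components_def)
      show "K \<in> ?r"
      proof (cases "conn inc F u x \<or> conn inc F u y")
        case True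
        then show ?thesis using D1 u by blast
      next
        case False
        then have "K = ?C u" "?C u \<noteq> ?C x" "?C u \<noteq> ?C y"
          using D2 u by (simp_all add: component_eq_iff)
        then show ?thesis using u by (auto simp: components_def)
      qed
    qed
    show "?r \<subseteq> ?l"
    proof
      fix K assume "K \<in> ?r"
      then consider "K = ?C x \<union> ?C y" | u where "u \<in> V" "K = ?C u" "?C u \<noteq> ?C x" "?C u \<noteq> ?C y"
        by (auto simp: components_def)
      then show "K \<in> ?l"
      proof cases
        case 1
        then have "K = ?D x" using D1[of x] by simp
        then show ?thesis using f by (auto simp: components_def)
      next
        case 2
        then have "K = ?D u" using D2[of u] by (simp add: component_eq_iff)
        then show ?thesis using 2 by (auto simp: components_def)
      qed
    qed
  qed
  \<comment> \<open>Were the union one of the old classes, \<open>F\<close> would already join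
    \<open>x\<close> to \<open>y\<close>.\<close>
  moreover have "?C x \<union> ?C y \<notin> components V inc F"
  proof
    assume "?C x \<union> ?C y \<in> components V inc F"
    then obtain u where "?C x \<union> ?C y = ?C u" by (auto simp: components_def)
    then have "x \<in> ?C u" "y \<in> ?C u" by (metis UnCI conn_refl mem_Collect_eq)+
    then have "conn inc F u x" "conn inc F u y" by simp_all
    then show False using F by (meson conn_sym conn_trans)
  qed
  moreover have "?C x \<in> components V inc F" "?C y \<in> components V inc F" "?C x \<noteq> ?C y"
    using f F by (auto simp: components_def component_eq_iff)
  moreover have fin: "finite (components V inc F)"
    using insert.prems by (simp add: components_def)
  \<comment> \<open>There are at least two old classes, so subtracting 2 from their number is not
    truncated.\<close>
  moreover have "card {?C x, ?C y} \<le> card (components V inc F)"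
    using calculation by (intro card_mono) auto
  ultimately have "card (components V inc (insert f F)) + 1 = card (components V inc F)"
    by (simp add: card_Diff_subset)
  moreover have "card F + card (components V inc F) = card V"
    using insert.prems F by (intro insert.IH) auto
  ultimately show ?case using insert.hyps by simp
qed

lemma card_forest_less:
  assumes "finite F" "finite V" "V \<noteq> {}" "forest inc F"
    and "\<And>e. e \<in> F \<Longrightarrow> inc e \<subseteq> V \<and> (\<exists>x y. inc e = {x, y})"
  shows "card F < card V"
proof -
  have "components V inc F \<noteq> {}" "finite (components V inc F)"
    using assms by (auto simp: components_def)
  then have "card (components V inc F) > 0" by (simp add: card_gt_0_iff)
  then show ?thesis using card_forest_components[of F V inc] assms by force
qed

text \<open>An edge outside \<open>B\<close> cannot be added, so by \<open>forest_insert\<close> its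
  ends are already joined in \<open>B\<close>.\<close>

lemma maximal_forest_conn:
  assumes B: "forest inc B" "B \<subseteq> E" "\<And>e. e \<in> E - B \<Longrightarrow> \<not> forest inc (insert e B)"
  shows "conn inc B = conn inc E"
proof -
  have 1: "conn inc B s t" if e: "e \<in> E" "inc e = {s, t}" for e s t
    using e B forest_insert[of inc e s t B] conn_edge[of e B inc s t] by blast
  have "conn inc B u w" if "conn inc E u w" for u w
    using that unfolding conn_def[of inc E]
  proof (induction rule: rtranclp_induct)
    case (step s t)
    then show ?case using 1 conn_trans by metis
  qed simp
  moreover have "conn inc E u w" if "conn inc B u w" for u w
    using that B(2) by (rule conn_mono)
  ultimately show ?thesis by (intro ext iffI)
qed

section \<open>Cycles as vertex and edge sequences\<close>

text \<open>The path is extended at its front; if the new vertex already lies on it, everything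
  before that occurrence is dropped instead.\<close>

lemma conn_imp_simple_path:
  assumes "conn inc F x y"
  shows "\<exists>vs es. length vs = Suc (length es) \<and> distinct vs \<and> set es \<subseteq> F \<and>
    vs ! 0 = x \<and> vs ! length es = y \<and> (\<forall>i < length es. inc (es ! i) = {vs ! i, vs ! Suc i})"
  using assms unfolding conn_def
proof (induction rule: converse_rtranclp_induct)
  case base
  have "length [y] = Suc (length [])" by simp
  then show ?case by (intro exI[of _ "[y]"] exI[of _ "[]"]) auto
next
  case (step x z)
  then obtain vs es e where p: "length vs = Suc (length es)" "distinct vs" "set es \<subseteq> F"
    "vs ! 0 = z" "vs ! length es = y" "\<forall>i < length es. inc (es ! i) = {vs ! i, vs ! Suc i}"
    and e: "e \<in> F" "inc e = {x, z}" by blast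
  show ?case
  proof (cases "x \<in> set vs")
    case False
    have "\<forall>i < length (e # es). inc ((e # es) ! i) = {(x # vs) ! i, (x # vs) ! Suc i}"
      using p e by (auto simp: nth_Cons split: nat.split)
    then show ?thesis using p e False
      by (intro exI[of _ "x # vs"] exI[of _ "e # es"]) auto
  next
    case True
    then obtain k where k: "k < length vs" "vs ! k = x" by (auto simp: in_set_conv_nth)
    show ?thesis using p k set_drop_subset[of k es]
      by (intro exI[of _ "drop k vs"] exI[of _ "drop k es"]) (auto simp: Suc_diff_le)
  qed
qed

text \<open>The edges of a cycle other than the last form a path between the ends of the last one.
  Conversely, an edge that is not a bridge closes a simple path between its ends; for a loop this
  path is a single vertex.\<close>

lemma cycle_iff_not_forest:
  assumes "\<And>e. e \<in> F \<Longrightarrow> \<exists>x y. inc e = {x, y}"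
  shows "has_cycle inc F \<longleftrightarrow> \<not> forest inc F"
proof
  assume "has_cycle inc F"
  then obtain vs es where c: "length vs = length es" "length es \<ge> 1" "distinct es" "set es \<subseteq> F"
    "\<forall>i < length es. inc (es ! i) = {vs ! i, vs ! ((i + 1) mod length es)}"
    unfolding has_cycle_def by blast
  let ?n = "length es - 1"
  let ?e = "es ! ?n"
  have n: "?n + 1 = length es" "?n < length es" using c(2) by linarith+
  have "inc ?e = {vs ! ?n, vs ! ((?n + 1) mod length es)}" using c(5) n(2) by blast
  then have e: "?e \<in> F" "inc ?e = {vs ! 0, vs ! ?n}"
    unfolding n(1) using c(4) nth_mem[OF n(2)] by (auto simp: insert_commute)
  have "conn inc (F - {?e}) (vs ! 0) (vs ! k)" if "k \<le> ?n" for k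
    using that
  proof (induction k)
    case (Suc k)
    have "es ! k \<in> F - {?e}"
      using Suc.prems c nth_mem[of k es] by (auto simp: nth_eq_iff_index_eq)
    moreover have "inc (es ! k) = {vs ! k, vs ! Suc k}" using Suc.prems c by auto
    ultimately show ?case using Suc conn_edge conn_trans by (metis Suc_leD)
  qed simp
  then show "\<not> forest inc F" using e unfolding forest_def by blast
next
  assume "\<not> forest inc F"
  then obtain e x y where e: "e \<in> F" "inc e = {x, y}" "conn inc (F - {e}) x y"
    unfolding forest_def by blast
  then obtain vs es where p: "length vs = Suc (length es)" "distinct vs" "set es \<subseteq> F - {e}"
    "vs ! 0 = x" "vs ! length es = y" "\<forall>i < length es. inc (es ! i) = {vs ! i, vs ! Suc i}"
    using conn_imp_simple_path by metis
  \<comment> \<open>An edge repeated at positions \<open>i < j\<close> would put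
    \<open>vs ! i\<close> among the later vertices \<open>vs ! j\<close> and
    \<open>vs ! Suc j\<close>.\<close>
  have "es ! i \<noteq> es ! j" if "i < j" "j < length es" for i j
  proof
    assume "es ! i = es ! j"
    then have "vs ! i \<in> {vs ! j, vs ! Suc j}" using p that by (metis insertI1 order_less_trans)
    then show False using p that by (auto simp: nth_eq_iff_index_eq)
  qed
  then have "distinct es" unfolding distinct_conv_nth by (metis linorder_neqE_nat)
  moreover have "inc ((es @ [e]) ! i) = {vs ! i, vs ! ((i + 1) mod length (es @ [e]))}"
    if "i < length (es @ [e])" for i
    using that p e by (cases "i = length es") (auto simp: nth_append insert_commute)
  ultimately show "has_cycle inc F" unfolding has_cycle_def
    using p e by (intro exI[of _ vs] exI[of _ "es @ [e]"]) auto
qed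

section \<open>Partitions into two forests and their moves\<close>

text \<open>An ordered partition into two forests is represented by its first part.\<close>

definition two_forest :: "('e \<Rightarrow> 'v set) \<Rightarrow> 'e set \<Rightarrow> 'e set \<Rightarrow> bool" where
  "two_forest inc E F \<longleftrightarrow> F \<subseteq> E \<and> forest inc F \<and> forest inc (E - F)"

text \<open>The edges \<open>p\<close> and \<open>q\<close> may coincide, or both change sides in
  the same direction. Once the sizes of both parts are fixed, only exchanges and trivial steps
  remain.\<close>

definition move :: "('e \<Rightarrow> 'v set) \<Rightarrow> 'e set \<Rightarrow> 'e set \<Rightarrow> 'e set \<Rightarrow> bool" where
  "move inc E F D \<longleftrightarrow> two_forest inc E F \<and> two_forest inc E D \<and>
     (\<exists>p q. (F - D) \<union> (D - F) \<subseteq> {p, q})"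

lemma move_sym: "move inc E F D \<Longrightarrow> move inc E D F"
  by (simp add: move_def Un_commute)

lemma moves_sym: "(move inc E)\<^sup>*\<^sup>* F D \<Longrightarrow> (move inc E)\<^sup>*\<^sup>* D F"
  by (rule sympD[OF symp_rtranclp]) (auto intro: sympI move_sym)

lemma moveI:
  "two_forest inc E F \<Longrightarrow> two_forest inc E D \<Longrightarrow> (F - D) \<union> (D - F) \<subseteq> {p, q} \<Longrightarrow> move inc E F D"
  unfolding move_def by blast

lemma two_forest_compl: "two_forest inc E F \<Longrightarrow> two_forest inc E (E - F)"
  unfolding two_forest_def by (metis Diff_subset double_diff order_refl)

text \<open>\<open>F\<close> and \<open>E - D\<close> differ in the same edges as
  \<open>E - F\<close> and \<open>D\<close>. This allows the two forests to be interchanged in later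
  case distinctions.\<close>

lemma move_compl: "move inc E (E - F) D \<Longrightarrow> F \<subseteq> E \<Longrightarrow> move inc E F (E - D)"
proof -
  assume m: "move inc E (E - F) D" and F: "F \<subseteq> E"
  then have D: "D \<subseteq> E" unfolding move_def two_forest_def by blast
  have "(F - (E - D)) \<union> (E - D - F) = ((E - F) - D) \<union> (D - (E - F))" "E - (E - F) = F"
    using F D by blast+
  then show ?thesis using m two_forest_compl unfolding move_def by metis
qed

text \<open>Otherwise every vertex on some edge has degree at least 4, and counting incidences gives
  at least twice as many edges as such vertices. Two forests have fewer.\<close>

lemma exists_low_degree:
  assumes E: "finite E" "E \<noteq> {}" "\<And>e. e \<in> E \<Longrightarrow> \<exists>x y. inc e = {x, y}"
    and F: "two_forest inc E F"
  shows "\<exists>v. {e \<in> E. v \<in> inc e} \<noteq> {} \<and> card {e \<in> E. v \<in> inc e} \<le> 3"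
proof (rule ccontr)
  assume no: "\<not> ?thesis"
  let ?V = "\<Union>(inc ` E)"
  have fV: "finite ?V" "?V \<noteq> {}" using E by (auto, force+)
  have c2: "card (inc e) \<le> 2" if "e \<in> E" for e
    using E(3)[OF that] by (auto simp: card_insert_if)
  have "card F < card ?V" "card (E - F) < card ?V"
    using E F fV finite_subset unfolding two_forest_def
    by (auto intro!: card_forest_less[where inc = inc])
  moreover have "card E = card F + card (E - F)"
    using E F unfolding two_forest_def by (metis card_Diff_subset card_mono finite_subset le_add_diff_inverse)
  ultimately have "card E < 2 * card ?V" by linarith
  have "4 * card ?V = (\<Sum>v\<in>?V. 4)" by simp
  also have "\<dots> \<le> (\<Sum>v\<in>?V. card {e \<in> E. v \<in> inc e})"
    using no by (intro sum_mono) (force simp: not_le)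
  also have "\<dots> = (\<Sum>e\<in>E. card {v \<in> ?V. v \<in> inc e})"
    using fV E by (intro sum_multicount_gen[symmetric]) auto
  also have "\<dots> \<le> (\<Sum>e\<in>E. 2)"
  proof (intro sum_mono)
    fix e assume e: "e \<in> E"
    then have "{v \<in> ?V. v \<in> inc e} = inc e" by blast
    then show "card {v \<in> ?V. v \<in> inc e} \<le> 2" using c2[OF e] by simp
  qed
  finally show False using \<open>card E < 2 * card ?V\<close> by simp
qed


section \<open>Vertices of degree at most 2\<close>

text \<open>The normal form puts \<open>a\<close> into the first forest and \<open>b\<close> into
  the second, where each is a leaf. Every partition is one step away from a normal form with the
  same remaining edges, and steps of the remaining edges lift to normal forms. The case
  \<open>a = b\<close> is degree 1.\<close>

lemma moves_connected_star_le_2: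
  assumes v: "{e \<in> E. v \<in> inc e} = S" "S = {a, b}"
    and leaf: "\<And>e. e \<in> S \<Longrightarrow> \<exists>x. inc e = {v, x} \<and> x \<noteq> v"
    and IH: "\<And>F D. two_forest inc (E - S) F \<Longrightarrow> two_forest inc (E - S) D \<Longrightarrow>
      (move inc (E - S))\<^sup>*\<^sup>* F D"
    and F: "two_forest inc E F" and D: "two_forest inc E D"
  shows "(move inc E)\<^sup>*\<^sup>* F D"
proof -
  have leaf_forest: "forest inc (insert p H)" if "p \<in> S" "forest inc H" "H \<subseteq> E - S" for p H
  proof -
    have "\<forall>e\<in>H. v \<notin> inc e" using that v by blast
    then show ?thesis using leaf[OF that(1)] that forest_insert_leaf by metis
  qed
  have lift: "two_forest inc E (insert a H)" if H: "two_forest inc (E - S) H" for H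
  proof -
    have "forest inc (insert a H)" using H v leaf_forest unfolding two_forest_def by blast
    \<comment> \<open>Only an inclusion, since for \<open>a = b\<close> the second forest contains
      no edge at \<open>v\<close>.\<close>
    moreover have "E - insert a H \<subseteq> insert b (E - S - H)" using v by blast
    moreover have "forest inc (insert b (E - S - H))"
      using H v leaf_forest[of b] unfolding two_forest_def by blast
    ultimately show ?thesis
      using H v unfolding two_forest_def by (blast intro: forest_subset)
  qed
  have rest: "two_forest inc (E - S) (H - S)" if "two_forest inc E H" for H
    using that unfolding two_forest_def 
    by (auto intro: forest_subset[of inc H] forest_subset[of inc "E - H"])
  have norm: "move inc E H (insert a (H - S))" if H: "two_forest inc E H" for H
    by (rule moveI[OF H lift[OF rest[OF H]], of a b]) (use v in blast)
  have "(move inc E)\<^sup>*\<^sup>* (insert a (F - S)) (insert a (D - S))"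
    using IH[OF rest[OF F] rest[OF D]]
  proof (induction rule: rtranclp_induct)
    case (step P Q)
    then have m: "move inc (E - S) P Q" by simp
    then have "a \<notin> P" "a \<notin> Q" using v unfolding move_def two_forest_def by auto
    then have "(insert a P - insert a Q) \<union> (insert a Q - insert a P) = (P - Q) \<union> (Q - P)" by blast
    then have "move inc E (insert a P) (insert a Q)"
      using m lift unfolding move_def by metis
    then show ?case using step.IH by simp
  qed simp
  then show ?thesis using norm[OF F] move_sym[OF norm[OF D]]
    by (meson converse_rtranclp_into_rtranclp rtranclp.rtrancl_into_rtrancl)
qed

section \<open>Vertices of degree 3\<close>

text \<open>When three edges are split two to one, \<open>p\<close> is the one by itself; which
  forest holds it is left open.\<close>

definition lone :: "'e set \<Rightarrow> 'e \<Rightarrow> 'e set \<Rightarrow> bool" where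
  "lone S p F \<longleftrightarrow> (\<forall>q\<in>S - {p}. q \<in> F \<longleftrightarrow> p \<notin> F)"

text \<open>The neighbours \<open>x\<close>, \<open>y\<close>, \<open>z\<close> may coincide.
  Results are stated for \<open>c\<close>; the assumptions are invariant under cyclic rotation of
  the edges together with their neighbours, which yields the versions for \<open>a\<close> and
  \<open>b\<close>.\<close>

locale cubic_vertex =
  fixes inc :: "'e \<Rightarrow> 'v set" and E R :: "'e set" and v :: 'v and a b c :: 'e and x y z :: 'v
  assumes E_eq: "E = insert a (insert b (insert c R))"
    and R_fresh: "a \<notin> R" "b \<notin> R" "c \<notin> R"
    and distinct: "a \<noteq> b" "a \<noteq> c" "b \<noteq> c"
    and ends: "inc a = {v, x}" "inc b = {v, y}" "inc c = {v, z}" "x \<noteq> v" "y \<noteq> v" "z \<noteq> v"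
    and R_avoids: "\<forall>e\<in>R. v \<notin> inc e"
begin

text \<open>An edge at \<open>v\<close> alone in its forest is a leaf and imposes no condition; two
  edges in the same forest act as an edge between their outer ends.\<close>

lemma two_forest_split:
  assumes H: "H \<subseteq> R"
  shows "two_forest inc E (insert a (insert b H)) \<longleftrightarrow>
      forest inc H \<and> \<not> conn inc H x y \<and> forest inc (R - H)"
    and "two_forest inc E (insert a (insert c H)) \<longleftrightarrow>
      forest inc H \<and> \<not> conn inc H x z \<and> forest inc (R - H)"
    and "two_forest inc E (insert b (insert c H)) \<longleftrightarrow>
      forest inc H \<and> \<not> conn inc H y z \<and> forest inc (R - H)"
    and "two_forest inc E (insert c H) \<longleftrightarrow>
      forest inc H \<and> forest inc (R - H) \<and> \<not> conn inc (R - H) x y"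
proof -
  have c: "E - insert a (insert b H) = insert c (R - H)"
    "E - insert a (insert c H) = insert b (R - H)"
    "E - insert b (insert c H) = insert a (R - H)"
    "E - insert c H = insert a (insert b (R - H))"
    using H R_fresh distinct unfolding E_eq by auto
  have H': "\<forall>e\<in>H. v \<notin> inc e" and R': "\<forall>e\<in>R - H. v \<notin> inc e" using H R_avoids by auto
  note s = forest_insert_leaf[OF _ _ H'] forest_insert_two[OF _ _ _ _ _ H']
     forest_insert_leaf[OF _ _ R'] forest_insert_two[OF _ _ _ _ _ R']
  have sub: "insert a (insert b H) \<subseteq> E" "insert a (insert c H) \<subseteq> E" "insert b (insert c H) \<subseteq> E"
    "insert c H \<subseteq> E" using H E_eq by auto
  show "two_forest inc E (insert a (insert b H)) \<longleftrightarrow>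
      forest inc H \<and> \<not> conn inc H x y \<and> forest inc (R - H)"
    unfolding two_forest_def c s(2)[OF ends(1,4,2,5) distinct(1)] s(3)[OF ends(3,6)] using sub by blast
  show "two_forest inc E (insert a (insert c H)) \<longleftrightarrow>
      forest inc H \<and> \<not> conn inc H x z \<and> forest inc (R - H)"
    unfolding two_forest_def c s(2)[OF ends(1,4,3,6) distinct(2)] s(3)[OF ends(2,5)] using sub by blast
  show "two_forest inc E (insert b (insert c H)) \<longleftrightarrow>
      forest inc H \<and> \<not> conn inc H y z \<and> forest inc (R - H)"
    unfolding two_forest_def c s(2)[OF ends(2,5,3,6) distinct(3)] s(3)[OF ends(1,4)] using sub by blast
  show "two_forest inc E (insert c H) \<longleftrightarrow>
      forest inc H \<and> forest inc (R - H) \<and> \<not> conn inc (R - H) x y"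
    unfolding two_forest_def c s(1)[OF ends(3,6)] s(4)[OF ends(1,4,2,5) distinct(1)] using sub by blast
qed

text \<open>As \<open>H\<close> does not join \<open>x\<close> to \<open>y\<close>, it does not join \<open>z\<close> to both of them.\<close>
lemma exchange_lone:
  assumes H: "H \<subseteq> R" and ab: "two_forest inc E (insert a (insert b H))"
  shows "two_forest inc E (insert a (insert c H)) \<or> two_forest inc E (insert b (insert c H))"
  using ab unfolding two_forest_split[OF H] by (meson conn_sym conn_trans)

text \<open>The reduced graph has edge set \<open>insert a R\<close>; the name \<open>a\<close> is
  reused for the edge that replaces \<open>v\<close>.\<close>

abbreviation "inc' \<equiv> inc(a := {x, y})"

text \<open>Both sides impose the same condition: the forest holding the new edge, or
  \<open>a\<close> and \<open>b\<close>, must not otherwise join \<open>x\<close> to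
  \<open>y\<close>.\<close>

lemma two_forest_reduced:
  assumes H: "H \<subseteq> R"
  shows "two_forest inc' (insert a R) (insert a H) \<longleftrightarrow> two_forest inc E (insert a (insert b H))"
    and "two_forest inc' (insert a R) H \<longleftrightarrow> two_forest inc E (insert c H)"
proof -
  have ins: "forest inc' (insert a P) \<longleftrightarrow> forest inc P \<and> \<not> conn inc P x y"
    and same: "forest inc' P \<longleftrightarrow> forest inc P" if "P \<subseteq> R" for P
  proof -
    have "a \<notin> P" using R_fresh that by blast
    then have "forest inc' P = forest inc P" "conn inc' P = conn inc P"
      by (metis forest_cong fun_upd_other) (metis \<open>a \<notin> P\<close> conn_cong fun_upd_other)
    then show "forest inc' (insert a P) \<longleftrightarrow> forest inc P \<and> \<not> conn inc P x y"
      "forest inc' P \<longleftrightarrow> forest inc P"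
      using forest_insert[of inc' a x y P] \<open>a \<notin> P\<close> by auto
  qed
  have "insert a R - insert a H = R - H" "insert a R - H = insert a (R - H)"
    using H R_fresh by auto
  then show "two_forest inc' (insert a R) (insert a H) \<longleftrightarrow> two_forest inc E (insert a (insert b H))"
    and "two_forest inc' (insert a R) H \<longleftrightarrow> two_forest inc E (insert c H)"
    unfolding two_forest_split[OF H] unfolding two_forest_def
    using ins[OF H] same[OF H] ins[of "R - H"] same[of "R - H"] H by (simp_all add: subset_insertI2)
qed

text \<open>Undoes the reduction: \<open>v\<close> subdivides the new edge into \<open>a\<close> and
  \<open>b\<close>, and \<open>c\<close> goes to the other forest.\<close>

definition lift :: "'e set \<Rightarrow> 'e set" where
  "lift P = (if a \<in> P then insert b P else insert c P)"

text \<open>The lifted partitions differ in all of \<open>a\<close>, \<open>b\<close>,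
  \<open>c\<close> and possibly one more edge, too many for one step. First \<open>c\<close> is
  exchanged with \<open>a\<close> or \<open>b\<close>, as \<open>exchange_lone\<close> permits; then
  the other of the two changes sides together with the remaining edge.\<close>

lemma lift_moves_mixed:
  assumes m: "move inc' (insert a R) P Q" and a: "a \<in> P" "a \<notin> Q"
  shows "(move inc E)\<^sup>*\<^sup>* (lift P) (lift Q)"
proof -
  define H where "H = P - {a}"
  have sub: "P \<subseteq> insert a R" "Q \<subseteq> insert a R" using m unfolding move_def two_forest_def by auto
  have H: "P = insert a H" "a \<notin> H" "H \<subseteq> R" "Q \<subseteq> R" using a sub unfolding H_def by auto
  have P: "two_forest inc E (insert a (insert b H))" and Q: "two_forest inc E (insert c Q)"
    using m two_forest_reduced H unfolding move_def by auto
  have "(P - Q) \<union> (Q - P) = insert a ((H - Q) \<union> (Q - H))" using H a by auto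
  moreover obtain q r where "(P - Q) \<union> (Q - P) \<subseteq> {q, r}" using m unfolding move_def by blast
  ultimately have "insert a ((H - Q) \<union> (Q - H)) \<subseteq> {q, r}" by simp
  moreover have "a \<notin> (H - Q) \<union> (Q - H)" using H a by blast
  \<comment> \<open>One of the two edges allowed to change sides is \<open>a\<close>, so at most one
    edge of \<open>R\<close> does.\<close>
  ultimately obtain p where p: "(H - Q) \<union> (Q - H) \<subseteq> {p}" by blast
  have "\<exists>K. move inc E (insert a (insert b H)) K \<and> move inc E K (insert c Q)"
    using exchange_lone[OF H(3) P]
  proof
    assume K: "two_forest inc E (insert a (insert c H))"
    have "move inc E (insert a (insert b H)) (insert a (insert c H))"
      by (rule moveI[OF P K, of b c]) blast
    moreover have "move inc E (insert a (insert c H)) (insert c Q)"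
      by (rule moveI[OF K Q, of a p]) (use p in blast)
    ultimately show ?thesis by blast
  next
    assume K: "two_forest inc E (insert b (insert c H))"
    have "move inc E (insert a (insert b H)) (insert b (insert c H))"
      by (rule moveI[OF P K, of a c]) blast
    moreover have "move inc E (insert b (insert c H)) (insert c Q)"
      by (rule moveI[OF K Q, of b p]) (use p in blast)
    ultimately show ?thesis by blast
  qed
  moreover have "lift P = insert a (insert b H)" "lift Q = insert c Q"
    using H a by (auto simp: lift_def)
  ultimately show ?thesis by (metis converse_rtranclp_into_rtranclp r_into_rtranclp)
qed

text \<open>If \<open>a\<close> stays on its side, so do \<open>b\<close> and \<open>c\<close>, and
  the lifted partitions differ in the same edges as \<open>P\<close> and \<open>Q\<close>. Otherwise
  the mixed case applies, possibly backwards.\<close>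

lemma lift_moves:
  assumes m: "move inc' (insert a R) P Q"
  shows "(move inc E)\<^sup>*\<^sup>* (lift P) (lift Q)"
proof -
  have sub: "P \<subseteq> insert a R" "Q \<subseteq> insert a R" using m unfolding move_def two_forest_def by auto
  consider "a \<in> P" "a \<notin> Q" | "a \<notin> P" "a \<in> Q" | "a \<in> P" "a \<in> Q" | "a \<notin> P" "a \<notin> Q" by blast
  then show ?thesis
  proof cases
    case 1
    then show ?thesis using lift_moves_mixed m by blast
  next
    case 2
    then show ?thesis using lift_moves_mixed[OF move_sym[OF m]] moves_sym by blast
  next
    case 3
    have "P = insert a (P - {a})" "Q = insert a (Q - {a})" "P - {a} \<subseteq> R" "Q - {a} \<subseteq> R"
      using 3 sub by auto
    then obtain H K where H: "P = insert a H" "Q = insert a K" "H \<subseteq> R" "K \<subseteq> R" by metis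
    have "(lift P - lift Q) \<union> (lift Q - lift P) = (P - Q) \<union> (Q - P)"
      using 3 sub R_fresh distinct unfolding lift_def by auto
    moreover have "lift P = insert a (insert b H)" "lift Q = insert a (insert b K)"
      using H by (auto simp: lift_def)
    ultimately have "move inc E (lift P) (lift Q)"
      using m H two_forest_reduced(1) unfolding move_def by metis
    then show ?thesis by blast
  next
    case 4
    then have H: "P \<subseteq> R" "Q \<subseteq> R" using sub by auto
    have "(lift P - lift Q) \<union> (lift Q - lift P) = (P - Q) \<union> (Q - P)"
      using 4 H R_fresh unfolding lift_def by auto
    then have "move inc E (lift P) (lift Q)"
      using m 4 H two_forest_reduced(2) unfolding move_def lift_def by metis
    then show ?thesis by blast
  qed
qed

lemma lone_cases:
  assumes F: "two_forest inc E F" and l: "lone {a, b, c} c F"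
  obtains H where "H \<subseteq> R" "F = insert a (insert b H)" | H where "H \<subseteq> R" "F = insert c H"
proof (cases "c \<in> F")
  case True
  then have "F - {c} \<subseteq> R" "F = insert c (F - {c})"
    using F l distinct unfolding two_forest_def lone_def E_eq by auto
  then show ?thesis using that by blast
next
  case False
  then have "F - {a, b} \<subseteq> R" "F = insert a (insert b (F - {a, b}))"
    using F l distinct unfolding two_forest_def lone_def E_eq by auto
  then show ?thesis using that by blast
qed

text \<open>Every partition with \<open>c\<close> alone is the lift of a partition of the reduced
  graph, so a path there lifts step by step.\<close>

lemma moves_connected_lone:
  assumes IH: "\<And>F D. two_forest inc' (insert a R) F \<Longrightarrow> two_forest inc' (insert a R) D \<Longrightarrow>
      (move inc' (insert a R))\<^sup>*\<^sup>* F D"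
    and F: "two_forest inc E F" "lone {a, b, c} c F"
    and D: "two_forest inc E D" "lone {a, b, c} c D"
  shows "(move inc E)\<^sup>*\<^sup>* F D"
proof -
  have ex: "\<exists>P. two_forest inc' (insert a R) P \<and> G = lift P"
    if G: "two_forest inc E G" "lone {a, b, c} c G" for G
    using G
  proof (cases rule: lone_cases)
    case (1 H)
    then show ?thesis using G two_forest_reduced(1)[of H]
      by (intro exI[of _ "insert a H"]) (auto simp: lift_def)
  next
    case (2 H)
    then show ?thesis using G two_forest_reduced(2)[of H] R_fresh
      by (intro exI[of _ H]) (auto simp: lift_def)
  qed
  obtain P Q where PQ: "two_forest inc' (insert a R) P" "F = lift P"
    "two_forest inc' (insert a R) Q" "D = lift Q" using ex[OF F] ex[OF D] by blast
  have "(move inc E)\<^sup>*\<^sup>* (lift P) (lift Q)" using IH[OF PQ(1,3)]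
  proof (induction rule: rtranclp_induct)
    case (step K L)
    then show ?case using lift_moves by (meson rtranclp_trans)
  qed simp
  then show ?thesis using PQ by simp
qed

text \<open>The edge exchanged with \<open>c\<close> becomes the lone one.\<close>

lemma leave_lone_aux:
  assumes "H \<subseteq> R" "two_forest inc E (insert a (insert b H))"
  shows "\<exists>q D. q \<in> {a, b} \<and> lone {a, b, c} q D \<and> move inc E (insert a (insert b H)) D"
  using exchange_lone[OF assms]
proof
  assume K: "two_forest inc E (insert a (insert c H))"
  have "move inc E (insert a (insert b H)) (insert a (insert c H))"
    by (rule moveI[OF assms(2) K, of b c]) blast
  moreover have "lone {a, b, c} b (insert a (insert c H))"
    using R_fresh assms(1) distinct by (auto simp: lone_def)
  ultimately show ?thesis by blast
next
  assume K: "two_forest inc E (insert b (insert c H))"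
  have "move inc E (insert a (insert b H)) (insert b (insert c H))"
    by (rule moveI[OF assms(2) K, of a c]) blast
  moreover have "lone {a, b, c} a (insert b (insert c H))"
    using R_fresh assms(1) distinct by (auto simp: lone_def)
  ultimately show ?thesis by blast
qed

lemma leave_lone:
  assumes F: "two_forest inc E F" "lone {a, b, c} c F"
  shows "\<exists>q D. q \<in> {a, b} \<and> lone {a, b, c} q D \<and> move inc E F D"
  using F
proof (cases rule: lone_cases)
  case (1 H)
  then show ?thesis using F leave_lone_aux by simp
next
  case (2 H)
  have sub: "F \<subseteq> E" using F unfolding two_forest_def by blast
  \<comment> \<open>If \<open>c\<close> lies in the first forest, the previous case applies to the
    complement.\<close>
  have "E - F = insert a (insert b (R - H))"
    using 2 R_fresh distinct unfolding E_eq by auto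
  then obtain q D where q: "q \<in> {a, b}" "lone {a, b, c} q D" and m: "move inc E (E - F) D"
    using leave_lone_aux[of "R - H"] two_forest_compl[OF F(1)] by auto
  have "move inc E F (E - D)" using m sub by (rule move_compl)
  moreover have "lone {a, b, c} q (E - D)"
    using q E_eq by (auto simp: lone_def)
  ultimately show ?thesis using q by blast
qed

text \<open>No edge is alone only if all three lie in the same forest; then \<open>c\<close> can
  move to the other one as a leaf.\<close>

lemma reach_lone:
  assumes F: "two_forest inc E F"
  shows "\<exists>p D. p \<in> {a, b, c} \<and> lone {a, b, c} p D \<and> (move inc E)\<^sup>*\<^sup>* F D"
proof -
  have up: "\<exists>D. lone {a, b, c} c D \<and> move inc E G D"
    if G: "two_forest inc E G" "a \<notin> G" "b \<notin> G" "c \<notin> G" for G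
  proof -
    have H: "G \<subseteq> R" using G unfolding two_forest_def E_eq by blast
    have "forest inc (insert c G)"
      using forest_insert_leaf[of inc c v z G] R_avoids H ends G unfolding two_forest_def by auto
    moreover have "forest inc (E - insert c G)"
      using G unfolding two_forest_def by (blast intro: forest_subset)
    ultimately have "two_forest inc E (insert c G)"
      using G E_eq unfolding two_forest_def by blast
    then have "move inc E G (insert c G)" by (rule moveI[OF G(1), of _ c c]) blast
    moreover have "lone {a, b, c} c (insert c G)" using G distinct by (auto simp: lone_def)
    ultimately show ?thesis by blast
  qed
  consider "a \<notin> F" "b \<notin> F" "c \<notin> F" | "a \<in> F" "b \<in> F" "c \<in> F"
    | p where "p \<in> {a, b, c}" "lone {a, b, c} p F"
    using distinct unfolding lone_def by blast
  then show ?thesis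
  proof cases
    case 1
    then show ?thesis using up[OF F] by blast
  next
    case 2
    then obtain D where l: "lone {a, b, c} c D" and m: "move inc E (E - F) D"
      using up[OF two_forest_compl[OF F]] by blast
    have sub: "F \<subseteq> E" using F unfolding two_forest_def by blast
    have "move inc E F (E - D)" using m sub by (rule move_compl)
    moreover have "lone {a, b, c} c (E - D)"
      using l E_eq by (auto simp: lone_def)
    ultimately show ?thesis by blast
  next
    case 3
    then show ?thesis by blast
  qed
qed

end

section \<open>The induction on the number of edges\<close>

text \<open>\<open>reach_lone\<close> leads into one of three classes,
  \<open>moves_connected_lone\<close> connects each class, and \<open>leave_lone\<close> links it to
  another. \<open>IH\<close> ranges over all incidence maps because the reduction changes the ends
  of an edge.\<close>

lemma moves_connected_star_3:
  fixes inc :: "'e \<Rightarrow> 'v set"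
  assumes cv: "cubic_vertex inc E R v a b c x y z"
    and E: "finite E" "\<And>e. e \<in> E \<Longrightarrow> \<exists>x y. inc e = {x, y}"
    and IH: "\<And>(E' :: 'e set) (inc' :: 'e \<Rightarrow> 'v set) F D. card E' < card E \<Longrightarrow> finite E' \<Longrightarrow>
      (\<And>e. e \<in> E' \<Longrightarrow> \<exists>x y. inc' e = {x, y}) \<Longrightarrow> two_forest inc' E' F \<Longrightarrow>
      two_forest inc' E' D \<Longrightarrow> (move inc' E')\<^sup>*\<^sup>* F D"
    and F: "two_forest inc E F" and D: "two_forest inc E D"
  shows "(move inc E)\<^sup>*\<^sup>* F D"
proof -
  let ?S = "{a, b, c}"
  have rot: "cubic_vertex inc E R v b c a y z x" "cubic_vertex inc E R v c a b z x y"
    using cv unfolding cubic_vertex_def by auto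
  have S: "{b, c, a} = ?S" "{c, a, b} = ?S" by auto
  have same_last: "(move inc E)\<^sup>*\<^sup>* P Q"
    if g: "cubic_vertex inc E R v p q r s t u" and P: "two_forest inc E P" "lone {p, q, r} r P"
      and Q: "two_forest inc E Q" "lone {p, q, r} r Q" for p q r s t u P Q
  proof -
    \<comment> \<open>The reduced graph has two edges fewer, so \<open>IH\<close> applies to
      it.\<close>
    have "insert p R \<subset> E" using g unfolding cubic_vertex_def by auto
    then have less: "card (insert p R) < card E" "finite (insert p R)"
      using E psubset_card_mono by (auto intro: finite_subset)
    have ends: "\<exists>x y. (inc(p := {s, t})) e = {x, y}" if "e \<in> insert p R" for e
      using that E \<open>insert p R \<subset> E\<close> by (cases "e = p") auto
    show ?thesis
      by (rule cubic_vertex.moves_connected_lone[OF g IH[of "insert p R" "inc(p := {s, t})", OF less ends] P Q])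
  qed
  have same: "(move inc E)\<^sup>*\<^sup>* P Q"
    if "p \<in> ?S" "two_forest inc E P" "lone ?S p P" "two_forest inc E Q" "lone ?S p Q" for p P Q
    using that same_last[OF cv] same_last[OF rot(1)] same_last[OF rot(2)] unfolding S by auto
  have leave: "\<exists>q Q. q \<in> ?S - {p} \<and> lone ?S q Q \<and> move inc E P Q"
    if "p \<in> ?S" "two_forest inc E P" "lone ?S p P" for p P
  proof -
    have "a \<noteq> b" "a \<noteq> c" "b \<noteq> c" using cv unfolding cubic_vertex_def by auto
    then show ?thesis
      using that cubic_vertex.leave_lone[OF cv, of P] cubic_vertex.leave_lone[OF rot(1), of P]
        cubic_vertex.leave_lone[OF rot(2), of P] unfolding S by blast
  qed
  have tf: "two_forest inc E Q" if "(move inc E)\<^sup>*\<^sup>* P Q" "two_forest inc E P" for P Q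
    using that by (induction rule: rtranclp_induct) (auto simp: move_def)
  \<comment> \<open>Each of the at most three nonempty classes of \<open>lone\<close> partitions is joined to another one,
    and a graph on three vertices without isolated vertices is connected.\<close>
  have lone_connected: "(move inc E)\<^sup>*\<^sup>* P Q"
    if p: "p \<in> ?S" "two_forest inc E P" "lone ?S p P"
      and q: "q \<in> ?S" "two_forest inc E Q" "lone ?S q Q" for p q P Q
  proof (cases "p = q")
    case True
    then show ?thesis using same p q by blast
  next
    case False
    obtain p' P' where p': "p' \<in> ?S - {p}" "lone ?S p' P'" "move inc E P P'"
      using leave[OF p] by blast
    obtain q' Q' where q': "q' \<in> ?S - {q}" "lone ?S q' Q'" "move inc E Q Q'"
      using leave[OF q] by blast
    have tf': "two_forest inc E P'" "two_forest inc E Q'" using p' q' by (auto simp: move_def)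
    have PP: "(move inc E)\<^sup>*\<^sup>* P P'" and QQ: "(move inc E)\<^sup>*\<^sup>* Q' Q"
      using p'(3) q'(3) move_sym by blast+
    \<comment> \<open>If neither of the first two holds, \<open>p'\<close> and \<open>q'\<close> are
      both the third edge.\<close>
    consider "p' = q" | "q' = p" | "p' = q'" using False p(1) q(1) p'(1) q'(1) by auto
    then show ?thesis
    proof cases
      case 1
      then have "(move inc E)\<^sup>*\<^sup>* P' Q" using same[OF q(1) tf'(1) _ q(2,3)] p' by blast
      then show ?thesis using PP by (meson rtranclp_trans)
    next
      case 2
      then have "(move inc E)\<^sup>*\<^sup>* P Q'" using same[OF p tf'(2)] q' by blast
      then show ?thesis using QQ by (meson rtranclp_trans)
    next
      case 3
      then have "(move inc E)\<^sup>*\<^sup>* P' Q'" using same[OF _ tf'(1) p'(2) tf'(2)] p' q' by blast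
      then show ?thesis using PP QQ by (meson rtranclp_trans)
    qed
  qed
  obtain p P where p: "p \<in> ?S" "lone ?S p P" "(move inc E)\<^sup>*\<^sup>* F P"
    using cubic_vertex.reach_lone[OF cv F] by blast
  obtain q Q where q: "q \<in> ?S" "lone ?S q Q" "(move inc E)\<^sup>*\<^sup>* D Q"
    using cubic_vertex.reach_lone[OF cv D] by blast
  have "(move inc E)\<^sup>*\<^sup>* P Q"
    using lone_connected[OF p(1) tf[OF p(3) F] p(2) q(1) tf[OF q(3) D] q(2)] .
  then show ?thesis using p(3) moves_sym[OF q(3)] by (meson rtranclp_trans)
qed

theorem moves_connected:
  assumes "finite E" "\<And>e. e \<in> E \<Longrightarrow> \<exists>x y. inc e = {x, y}"
    and "two_forest inc E F" "two_forest inc E D"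
  shows "(move inc E)\<^sup>*\<^sup>* F D"
  using assms
proof (induction "card E" arbitrary: E inc F D rule: less_induct)
  case less
  note E = less.prems(1,2) and F = less.prems(3) and D = less.prems(4)
  show ?case
  proof (cases "E = {}")
    case True
    then have "F = D" using F D by (auto simp: two_forest_def)
    then show ?thesis by simp
  next
    case False
    obtain v where v: "{e \<in> E. v \<in> inc e} \<noteq> {}" "card {e \<in> E. v \<in> inc e} \<le> 3"
      using exists_low_degree[OF E(1) False E(2) F] by blast
    define S where "S = {e \<in> E. v \<in> inc e}"
    have leaf: "\<exists>x. inc e = {v, x} \<and> x \<noteq> v" if e: "e \<in> S" for e
    proof -
      obtain x y where xy: "inc e = {x, y}" using E(2) e S_def by blast
      \<comment> \<open>A loop lies in no forest, while each edge lies in \<open>F\<close> or in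
        \<open>E - F\<close>.\<close>
      have "x \<noteq> y"
        using F e xy forest_ends_neq[of inc F e x y] forest_ends_neq[of inc "E - F" e x y]
        unfolding two_forest_def S_def by blast
      then show ?thesis using xy e unfolding S_def by auto
    qed
    have finS: "finite S" "S \<subseteq> E" "S \<noteq> {}" using E v unfolding S_def by auto
    \<comment> \<open>The first case includes degree 1, with \<open>a = b\<close>.\<close>
    consider a b where "S = {a, b}"
      | a b c where "S = {a, b, c}" "a \<noteq> b" "a \<noteq> c" "b \<noteq> c"
    proof -
      have "card S \<noteq> 0" using finS by simp
      then have "card S = 1 \<or> card S = 2 \<or> card S = 3" using v(2) unfolding S_def by linarith
      then consider "card S = 1" | "card S = 2" | "card S = 3" by blast
      then show ?thesis
      proof cases
        case 1
        then obtain a where "S = {a, a}" by (auto simp: card_1_singleton_iff)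
        then show ?thesis by (rule that(1))
      next
        case 2
        then show ?thesis using that(1) by (auto simp: card_2_iff)
      next
        case 3
        then obtain a b c where "S = {a, b, c}" "a \<noteq> b" "b \<noteq> c" "a \<noteq> c"
          by (auto simp: card_3_iff)
        then show ?thesis using that(2) by blast
      qed
    qed
    then show ?thesis
    proof cases
      case (1 a b)
      have "card (E - S) < card E" using finS E by (intro psubset_card_mono) auto
      then have "(move inc (E - S))\<^sup>*\<^sup>* P Q"
        if "two_forest inc (E - S) P" "two_forest inc (E - S) Q" for P Q
        using less.hyps[of "E - S" inc P Q] E that by auto
      then show ?thesis
        using moves_connected_star_le_2[OF S_def[symmetric] 1 leaf _ F D] by blast
    next
      case (2 a b c)
      obtain x y z where "inc a = {v, x}" "x \<noteq> v" "inc b = {v, y}" "y \<noteq> v" "inc c = {v, z}" "z \<noteq> v"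
        using leaf[of a] leaf[of b] leaf[of c] 2 by auto
      then have "cubic_vertex inc E (E - S) v a b c x y z"
        using 2 finS unfolding cubic_vertex_def by (auto simp: S_def)
      then show ?thesis using moves_connected_star_3[OF _ E less.hyps F D] by blast
    qed
  qed
qed

section \<open>Bases of the cycle matroid\<close>

lemma cm_basis_conn:
  assumes inc: "\<And>e. e \<in> E \<Longrightarrow> \<exists>x y. inc e = {x, y}" and B: "cm_basis E inc B"
  shows "B \<subseteq> E" "forest inc B" "conn inc B = conn inc E"
proof -
  have ac: "acyclic_set E inc F \<longleftrightarrow> F \<subseteq> E \<and> forest inc F" for F
    using cycle_iff_not_forest[of F inc] inc unfolding acyclic_set_def by blast
  show *: "B \<subseteq> E" "forest inc B" using B unfolding cm_basis_def ac by auto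
  show "conn inc B = conn inc E"
    using B unfolding cm_basis_def ac by (intro maximal_forest_conn[OF *(2,1)]) blast
qed

text \<open>\<open>cm_rank\<close> is a maximum of cardinalities, whereas bases are maximal under
  inclusion. The link is that every basis has the components of the whole graph, whose number
  determines its size.\<close>

lemma
  assumes G: "graph V E inc"
  shows graph_ends: "e \<in> E \<Longrightarrow> \<exists>x y. inc e = {x, y}"
    and card_cm_basis: "cm_basis E inc B \<Longrightarrow> card B = cm_rank E inc"
    and card_forest_le: "F \<subseteq> E \<Longrightarrow> forest inc F \<Longrightarrow> card F \<le> cm_rank E inc"
    and cm_basisI: "F \<subseteq> E \<Longrightarrow> forest inc F \<Longrightarrow> card F = cm_rank E inc \<Longrightarrow> cm_basis E inc F"
proof -
  have fin: "finite V" "finite E" using G unfolding graph_def by auto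
  show ends: "\<exists>x y. inc e = {x, y}" if "e \<in> E" for e
  proof -
    have "card (inc e) = 1 \<or> card (inc e) = 2" using G that unfolding graph_def by blast
    then obtain x y where "inc e = {x} \<or> inc e = {x, y}"
      by (metis card_1_singletonE card_2_iff)
    then show ?thesis by (metis insert_absorb2)
  qed
  have ac: "acyclic_set E inc F \<longleftrightarrow> F \<subseteq> E \<and> forest inc F" for F
    using cycle_iff_not_forest[of F inc] ends unfolding acyclic_set_def by blast
  let ?A = "card ` {F. acyclic_set E inc F}"
  have A: "finite ?A" "?A \<noteq> {}"
    using fin by (auto simp: ac intro: finite_subset[of _ "Pow E"] exI[of _ "{}"])
  show le: "card F \<le> cm_rank E inc" if "F \<subseteq> E" "forest inc F" for F
    unfolding cm_rank_def using that by (intro Max_ge A(1)) (auto simp: ac)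
  show basis: "cm_basis E inc F" if F: "F \<subseteq> E" "forest inc F" "card F = cm_rank E inc" for F
    unfolding cm_basis_def ac
  proof (intro conjI allI impI F(1,2))
    fix H assume H: "(H \<subseteq> E \<and> forest inc H) \<and> F \<subseteq> H"
    then have "card H \<le> card F" "finite H" using le F fin by (auto intro: finite_subset)
    then show "H = F" using H by (metis card_seteq)
  qed
  show "card B = cm_rank E inc" if B: "cm_basis E inc B"
  proof -
    have "cm_rank E inc \<in> ?A" unfolding cm_rank_def using A by (rule Max_in)
    then obtain M where M: "M \<subseteq> E" "forest inc M" "card M = cm_rank E inc" by (auto simp: ac)
    note MB = cm_basis_conn[of E inc, OF ends basis[OF M]] cm_basis_conn[of E inc, OF ends B]
    have sum: "card F + card (components V inc F) = card V" if "F \<subseteq> E" "forest inc F" for F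
      using that fin ends G unfolding graph_def
      by (intro card_forest_components) (auto intro: finite_subset)
    have "components V inc M = components V inc B" using MB unfolding components_def by simp
    then show ?thesis using sum[OF M(1,2)] sum[of B] MB M(3) by simp
  qed
qed

section \<open>From moves to the single exchange graph\<close>

theorem theorem4p1:
  fixes V :: "'v set" and E :: "'e set" and inc :: "'e \<Rightarrow> 'v set"
  assumes "graph V E inc"
    and "card E = 2 * cm_rank E inc"
  shows "exch_graph_connected E inc"
proof -
  note G = assms(1)
  let ?r = "cm_rank E inc"
  have fin: "finite E" using G unfolding graph_def by auto
  note ends = graph_ends[OF G]
  have vertexD: "two_forest inc E B \<and> C = E - B" if "(B, C) \<in> exch_vertices E inc" for B C
  proof -
    have BC: "cm_basis E inc B" "cm_basis E inc C" "B \<inter> C = {}"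
      using that unfolding exch_vertices_def by auto
    have sub: "B \<subseteq> E" "C \<subseteq> E" "forest inc B" "forest inc C"
      using cm_basis_conn(1,2)[of E inc, OF ends] BC by auto
    \<comment> \<open>Two disjoint bases have \<open>2 * ?r\<close> edges together, hence exhaust
      \<open>E\<close>.\<close>
    have "card (B \<union> C) = card E"
      using card_Un_disjoint[OF _ _ BC(3)] sub fin card_cm_basis[OF G] BC assms(2)
      by (simp add: finite_subset)
    then have "B \<union> C = E" using sub fin by (intro card_subset_eq) auto
    then have "C = E - B" using BC(3) by blast
    then show ?thesis using sub unfolding two_forest_def by simp
  qed
  have vertexI: "(F, E - F) \<in> exch_vertices E inc \<and> card F = ?r" if F: "two_forest inc E F" for F
  proof -
    \<comment> \<open>Neither part exceeds the rank and the sizes add up to twice the rank, so both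
      attain it and are bases.\<close>
    have "card F \<le> ?r" "card (E - F) \<le> ?r"
      using F card_forest_le[OF G] unfolding two_forest_def by auto
    moreover have "card (E - F) = card E - card F" "card F \<le> card E"
      using F fin unfolding two_forest_def by (auto intro: card_Diff_subset finite_subset card_mono)
    ultimately have "card F = ?r" "card (E - F) = ?r" using assms(2) by linarith+
    then show ?thesis using F cm_basisI[OF G] unfolding two_forest_def exch_vertices_def by auto
  qed
  have adj: "(exch_adj E inc)\<^sup>*\<^sup>* (F, E - F) (D, E - D)" if m: "move inc E F D" for F D
  proof (cases "F = D")
    case False
    have FD: "two_forest inc E F" "two_forest inc E D" using m by (auto simp: move_def)
    have fFD: "finite F" "finite D" using FD fin unfolding two_forest_def by (auto intro: finite_subset)
    obtain p q where pq: "(F - D) \<union> (D - F) \<subseteq> {p, q}" using m by (auto simp: move_def)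
    \<comment> \<open>\<open>F\<close> and \<open>D\<close> have equal size, so \<open>F - D\<close>
      and \<open>D - F\<close> do as well. Together they have at most two edges, and as
      \<open>F\<close> and \<open>D\<close> differ, exactly one each.\<close>
    have eq: "card (F \<inter> D) + card (F - D) = ?r" "card (F \<inter> D) + card (D - F) = ?r"
      using card_Int_Diff[OF fFD(1), of D] card_Int_Diff[OF fFD(2), of F] vertexI FD
      by (auto simp: Int_commute)
    have "card (F - D) + card (D - F) = card ((F - D) \<union> (D - F))"
      using fFD by (intro card_Un_disjoint[symmetric]) auto
    also have "\<dots> \<le> card {p, q}" using pq by (intro card_mono) auto
    also have "\<dots> \<le> 2" by (simp add: card_insert_if)
    finally have "card (F - D) \<le> 1" using eq by linarith
    moreover have "card (F - D) \<noteq> 0"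
    proof
      assume "card (F - D) = 0"
      then have "card (D - F) = 0" "card (F - D) = 0" using eq by simp_all
      then have "D - F = {}" "F - D = {}" using fFD by simp_all
      then show False using False by blast
    qed
    ultimately have "card (F \<inter> D) = ?r - 1" using eq by linarith
    then have "exch_adj E inc (F, E - F) (D, E - D)"
      using vertexI FD unfolding exch_adj_def by auto
    then show ?thesis by blast
  qed simp
  have path: "(exch_adj E inc)\<^sup>*\<^sup>* (F, E - F) (D, E - D)" if "(move inc E)\<^sup>*\<^sup>* F D" for F D
    using that
  proof (induction rule: rtranclp_induct)
    case (step P Q)
    then show ?case using adj by (meson rtranclp_trans)
  qed simp
  show ?thesis unfolding exch_graph_connected_def
  proof (intro ballI)
    fix X Y assume XY: "X \<in> exch_vertices E inc" "Y \<in> exch_vertices E inc"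
    obtain B C B' C' where eq: "X = (B, C)" "Y = (B', C')" by (metis surj_pair)
    have B: "two_forest inc E B" "C = E - B" "two_forest inc E B'" "C' = E - B'"
      using vertexD[of B C] vertexD[of B' C'] XY eq by auto
    have "(move inc E)\<^sup>*\<^sup>* B B'" by (rule moves_connected[OF fin ends B(1,3)])
    then show "(exch_adj E inc)\<^sup>*\<^sup>* X Y" unfolding eq B(2,4) by (rule path)
  qed
qed

end
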